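(* Let $l>0$ and let $\lambda(\alpha)=[\eta(\alpha)]^{l+2}e^{-\alpha}$ and $U(x;\alpha)=w(\eta(\alpha)|x|)+\alpha$ for $\alpha>0$, $x\in[-1,1]$, with $w,\eta$ as in the context. Then $\lambda(\alpha)\in C^2(0,\infty)$, $U(x;\alpha)\in C^2([-1,1]\times(0,\infty))$, and \[ \lim_{\alpha\to+0}\lambda(\alpha)=\lim_{\alpha\to\infty}\lambda(\alpha)=0. \] Moreover, there exists $\alpha_*>0$ such that $\lambda'(\alpha)>0$ for $0<\alpha<\alpha_*$, $\lambda'(\alpha_* )=0$, and $\lambda'(\alpha)<0$ for $\alpha>\alpha_*$.
   Context: $w$ is the unique solution of $w''+|x|^l e^w=0$ for $x>0$, $w(0)=w'(0)=0$. It satisfies $w,w',w''<0$ on $(0,\infty)$ and $w(x)\to-\infty$ as $x\to\infty$, and $\eta:[0,\infty)\to[0,\infty)$ denotes the inverse function of $-w$. *)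

theory Defs
  imports "HOL-Analysis.Analysis"
begin

text \<open>
  Solutions on \<open>[0, \<infinity>)\<close> of the initial value problem \<open>w'' + |x|^l e^w = 0\<close>,
  \<open>w(0) = w'(0) = 0\<close>. The derivative at \<open>0\<close> is one-sided; the values of \<open>w\<close> on the
  negative half-line are irrelevant.
\<close>

definition solves_ivp :: "real \<Rightarrow> (real \<Rightarrow> real) \<Rightarrow> bool" where
  "solves_ivp l w \<longleftrightarrow>
     (\<exists>w'. (\<forall>x\<ge>0. (w has_real_derivative w' x) (at x within {0..})) \<and>
           (\<forall>x>0. (w' has_real_derivative - (\<bar>x\<bar> powr l * exp (w x))) (at x)) \<and>
           w 0 = 0 \<and> w' 0 = 0)"

definition eta :: "(real \<Rightarrow> real) \<Rightarrow> real \<Rightarrow> real" where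
  "eta w = inv_into {0..} (\<lambda>x. - w x)"

definition lam :: "real \<Rightarrow> (real \<Rightarrow> real) \<Rightarrow> real \<Rightarrow> real" where
  "lam l w \<alpha> = eta w \<alpha> powr (l + 2) * exp (- \<alpha>)"

definition U :: "(real \<Rightarrow> real) \<Rightarrow> real \<Rightarrow> real \<Rightarrow> real" where
  "U w x \<alpha> = w (eta w \<alpha> * \<bar>x\<bar>) + \<alpha>"

text \<open>
  Class \<open>C\<^sup>2\<close> on a set. At boundary points belonging to the set, derivatives are taken
  within the set (one-sided). Meant for sets such as open sets or convex sets with nonempty
  interior, where the derivative within the set is unique.
\<close>

definition C1_on :: "'a::real_normed_vector set \<Rightarrow> ('a \<Rightarrow> 'b::real_normed_vector) \<Rightarrow> bool" where
  "C1_on S f \<longleftrightarrow>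
     (\<exists>f' :: 'a \<Rightarrow> 'a \<Rightarrow>\<^sub>L 'b.
        (\<forall>x\<in>S. (f has_derivative blinfun_apply (f' x)) (at x within S)) \<and> continuous_on S f')"

definition C2_on :: "'a::real_normed_vector set \<Rightarrow> ('a \<Rightarrow> 'b::real_normed_vector) \<Rightarrow> bool" where
  "C2_on S f \<longleftrightarrow>
     (\<exists>f' :: 'a \<Rightarrow> 'a \<Rightarrow>\<^sub>L 'b.
        (\<forall>x\<in>S. (f has_derivative blinfun_apply (f' x)) (at x within S)) \<and> C1_on S f')"

end

theory Submission
  imports Defs "HOL-Real_Asymp.Real_Asymp"
begin

text \<open>
  Write \<open>v = w'\<close>. In the variable \<open>x = \<eta>(\<alpha>)\<close>, i.e. \<open>\<alpha> = - w x\<close>, the function \<open>\<lambda>\<close> becomes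
  \<open>x powr (l + 2) * exp (w x)\<close>, whose logarithmic derivative is \<open>(l + 2 + x * v x) / x\<close>. As \<open>v\<close>
  is negative and strictly decreasing, \<open>x * v x\<close> decreases strictly from \<open>0\<close> to \<open>-\<infinity>\<close>, so
  the sign changes exactly once. The bound \<open>w x \<le> v 1 * (x - 1)\<close> for \<open>x \<ge> 1\<close> makes \<open>\<eta>\<close> grow
  at most linearly, and the exponential wins at infinity. For the regularity of \<open>U\<close> at \<open>x = 0\<close>, the
  even extension of \<open>w\<close> is twice continuously differentiable on the whole line, since its second
  derivative \<open>- \<bar>y\<bar> powr l * exp (w \<bar>y\<bar>)\<close> is continuous.
\<close>

section \<open>Calculus of \<open>C\<^sup>1\<close> functions\<close>

text \<open>The derivative is multiplication by \<open>f' x\<close>; this operator depends linearly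
  and boundedly on its factor, so it inherits continuity from \<open>f'\<close>.\<close>

lemma C1_onI_real:
  fixes f :: "real \<Rightarrow> real"
  assumes "\<And>x. x \<in> S \<Longrightarrow> (f has_real_derivative f' x) (at x within S)" "continuous_on S f'"
  shows "C1_on S f"
  unfolding C1_on_def
proof (intro exI conjI ballI)
  show "(f has_derivative blinfun_apply (blinfun_mult_right (f' x))) (at x within S)" if "x \<in> S" for x
    using assms(1)[OF that] by (simp add: has_field_derivative_def blinfun_mult_right.rep_eq)
  show "continuous_on S (\<lambda>x. blinfun_mult_right (f' x))"
    by (rule bounded_linear.continuous_on[OF bounded_linear_blinfun_mult_right assms(2)])
qed

lemma C1_on_imp_continuous_on: "C1_on S f \<Longrightarrow> continuous_on S f"
  unfolding C1_on_def by (meson has_derivative_continuous continuous_on_eq_continuous_within)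

lemma C1_on_const: "C1_on S (\<lambda>x. c)"
  unfolding C1_on_def by (rule exI[of _ "\<lambda>_. 0"]) (auto simp: zero_blinfun.rep_eq)

lemma C1_on_bounded_linear:
  assumes "bounded_linear f"
  shows "C1_on S f"
  unfolding C1_on_def
proof (intro exI conjI ballI)
  show "(f has_derivative blinfun_apply (Blinfun f)) (at x within S)" for x
    using assms by (simp add: bounded_linear_Blinfun_apply bounded_linear_imp_has_derivative)
qed auto

lemma C1_on_add:
  assumes "C1_on S f" "C1_on S g"
  shows "C1_on S (\<lambda>x. f x + g x)"
proof -
  obtain f' g' where *:
    "\<And>x. x \<in> S \<Longrightarrow> (f has_derivative blinfun_apply (f' x)) (at x within S)" "continuous_on S f'"
    "\<And>x. x \<in> S \<Longrightarrow> (g has_derivative blinfun_apply (g' x)) (at x within S)" "continuous_on S g'"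
    using assms unfolding C1_on_def by blast
  show ?thesis
    unfolding C1_on_def
  proof (intro exI conjI ballI)
    fix x assume x: "x \<in> S"
    show "((\<lambda>x. f x + g x) has_derivative blinfun_apply (f' x + g' x)) (at x within S)"
      using has_derivative_add[OF *(1)[OF x] *(3)[OF x]] by (simp add: plus_blinfun.rep_eq)
  qed (rule continuous_on_add[OF *(2,4)])
qed

text \<open>Product rule with vector-valued \<open>g\<close>: besides ordinary products, it covers
  operator-valued derivatives assembled from real coefficients, as the second-order criteria
  require.\<close>

lemma C1_on_scaleR:
  fixes f :: "'a::real_normed_vector \<Rightarrow> real" and g :: "'a \<Rightarrow> 'b::real_normed_vector"
  assumes "C1_on S f" "C1_on S g"
  shows "C1_on S (\<lambda>x. f x *\<^sub>R g x)"
proof -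
  obtain f' g' where *:
    "\<And>x. x \<in> S \<Longrightarrow> (f has_derivative blinfun_apply (f' x)) (at x within S)" "continuous_on S f'"
    "\<And>x. x \<in> S \<Longrightarrow> (g has_derivative blinfun_apply (g' x)) (at x within S)" "continuous_on S g'"
    using assms unfolding C1_on_def by blast
  show ?thesis
    unfolding C1_on_def
  proof (intro exI conjI ballI)
    fix x assume x: "x \<in> S"
    show "((\<lambda>x. f x *\<^sub>R g x) has_derivative
        blinfun_apply (f x *\<^sub>R g' x + (blinfun_scaleR_left (g x) o\<^sub>L f' x))) (at x within S)"
      using has_derivative_scaleR[OF *(1)[OF x] *(3)[OF x]]
      by (simp add: plus_blinfun.rep_eq scaleR_blinfun.rep_eq)
  next
    show "continuous_on S (\<lambda>x. f x *\<^sub>R g' x + (blinfun_scaleR_left (g x) o\<^sub>L f' x))"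
      by (rule continuous_on_add[OF continuous_on_scaleR[OF C1_on_imp_continuous_on[OF assms(1)] *(4)]
          bounded_bilinear.continuous_on[OF bounded_bilinear_blinfun_compose
            bounded_linear.continuous_on[OF bounded_linear_blinfun_scaleR_left
              C1_on_imp_continuous_on[OF assms(2)]] *(2)]])
  qed
qed

lemma C1_on_mult:
  fixes f g :: "'a::real_normed_vector \<Rightarrow> real"
  assumes "C1_on S f" "C1_on S g"
  shows "C1_on S (\<lambda>x. f x * g x)"
  using C1_on_scaleR[OF assms] by simp

lemma C1_on_compose:
  assumes "C1_on T g" "C1_on S f" "f ` S \<subseteq> T"
  shows "C1_on S (\<lambda>x. g (f x))"
proof -
  obtain f' where f':
    "\<And>x. x \<in> S \<Longrightarrow> (f has_derivative blinfun_apply (f' x)) (at x within S)" "continuous_on S f'"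
    using assms(2) unfolding C1_on_def by blast
  obtain g' where g':
    "\<And>x. x \<in> T \<Longrightarrow> (g has_derivative blinfun_apply (g' x)) (at x within T)" "continuous_on T g'"
    using assms(1) unfolding C1_on_def by blast
  show ?thesis
    unfolding C1_on_def
  proof (intro exI conjI ballI)
    fix x assume x: "x \<in> S"
    show "((\<lambda>x. g (f x)) has_derivative blinfun_apply (g' (f x) o\<^sub>L f' x)) (at x within S)"
      using has_derivative_in_compose2[OF g'(1) assms(3) x f'(1)[OF x]]
      by (simp add: blinfun_compose.rep_eq o_def)
  next
    show "continuous_on S (\<lambda>x. g' (f x) o\<^sub>L f' x)"
      by (rule bounded_bilinear.continuous_on[OF bounded_bilinear_blinfun_compose
            continuous_on_compose2[OF g'(2) C1_on_imp_continuous_on[OF assms(2)] assms(3)] f'(2)])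
  qed
qed

lemma C1_on_inverse:
  fixes f :: "'a::real_normed_vector \<Rightarrow> real"
  assumes "C1_on S f" "\<And>x. x \<in> S \<Longrightarrow> f x \<noteq> 0"
  shows "C1_on S (\<lambda>x. inverse (f x))"
proof (rule C1_on_compose[of "-{0}" inverse])
  show "C1_on (-{0}) (inverse :: real \<Rightarrow> real)"
  proof (rule C1_onI_real)
    show "(inverse has_real_derivative - (inverse x ^ Suc (Suc 0))) (at x within - {0})"
      if "x \<in> - {0}" for x :: real
      using that by (intro DERIV_inverse) simp
    show "continuous_on (- {0}) (\<lambda>x::real. - (inverse x ^ Suc (Suc 0)))"
      by (intro continuous_intros) simp
  qed
qed (use assms in auto)

text \<open>The derivative operator is the scalar \<open>f' x\<close> times the identity, so the
  \<open>C1_on\<close> property of the scalar passes to the operator.\<close>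

lemma C2_onI_real:
  fixes f :: "real \<Rightarrow> real"
  assumes "\<And>x. x \<in> S \<Longrightarrow> (f has_real_derivative f' x) (at x within S)" "C1_on S f'"
  shows "C2_on S f"
  unfolding C2_on_def
proof (intro exI conjI ballI)
  show "(f has_derivative blinfun_apply (f' x *\<^sub>R id_blinfun)) (at x within S)" if "x \<in> S" for x
    using assms(1)[OF that] by (simp add: has_field_derivative_def scaleR_blinfun.rep_eq)
  show "C1_on S (\<lambda>x. f' x *\<^sub>R id_blinfun)"
    by (intro C1_on_scaleR C1_on_const assms)
qed

text \<open>The coefficients \<open>a\<close> and \<open>b\<close> are the two partial derivatives;
  the differential is their combination with the fixed coordinate projections.\<close>

lemma C2_onI_prod:
  fixes f :: "real \<times> real \<Rightarrow> real"
  assumes "\<And>p. p \<in> S \<Longrightarrow> (f has_derivative (\<lambda>(h, k). a p * h + b p * k)) (at p within S)"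
    and "C1_on S a" "C1_on S b"
  shows "C2_on S f"
  unfolding C2_on_def
proof (intro exI conjI ballI)
  show "(f has_derivative blinfun_apply (a p *\<^sub>R fst_blinfun + b p *\<^sub>R snd_blinfun)) (at p within S)"
    if "p \<in> S" for p
    using assms(1)[OF that] by (simp add: scaleR_blinfun.rep_eq plus_blinfun.rep_eq case_prod_unfold)
  show "C1_on S (\<lambda>p. a p *\<^sub>R fst_blinfun + b p *\<^sub>R snd_blinfun)"
    by (intro C1_on_scaleR C1_on_add C1_on_const assms)
qed

section \<open>Even and odd extensions\<close>

lemma has_real_derivative_abs_comp:
  fixes f :: "real \<Rightarrow> real"
  assumes "(f has_real_derivative d) (at \<bar>x\<bar>)" "x \<noteq> 0"
  shows "((\<lambda>y. f \<bar>y\<bar>) has_real_derivative sgn x * d) (at x)"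
proof -
  have "(norm has_derivative (\<lambda>h. sgn x * h)) (at x)"
    using has_derivative_norm[OF assms(2)] by (simp add: mult.commute)
  then have "((\<lambda>y. \<bar>y\<bar>) has_real_derivative sgn x) (at x)"
    unfolding has_field_derivative_def real_norm_def[abs_def] .
  from DERIV_chain2[OF assms(1) this] show ?thesis
    by (simp add: mult.commute)
qed

text \<open>Away from 0 the sign is locally constant, and it cancels the sign produced by
  differentiating the absolute value.\<close>

lemma has_real_derivative_sgn_abs_comp:
  fixes f :: "real \<Rightarrow> real"
  assumes "(f has_real_derivative d) (at \<bar>x\<bar>)" "x \<noteq> 0"
  shows "((\<lambda>y. sgn y * f \<bar>y\<bar>) has_real_derivative d) (at x)"
proof -
  have "((\<lambda>y. sgn x * f \<bar>y\<bar>) has_real_derivative sgn x * (sgn x * d)) (at x)"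
    by (intro DERIV_cmult has_real_derivative_abs_comp assms)
  moreover have "sgn x * (sgn x * d) = d"
    using assms(2) by (simp add: sgn_if)
  ultimately have deriv: "((\<lambda>y. sgn x * f \<bar>y\<bar>) has_real_derivative d) (at x)"
    by (simp only:)
  have sgn_eq: "\<forall>\<^sub>F y in nhds x. sgn y = sgn x"
  proof (cases "x > 0")
    case True
    then show ?thesis
      using eventually_nhds_in_open[of "{0<..}" x] by (auto elim: eventually_mono)
  next
    case False
    then show ?thesis
      using assms(2) eventually_nhds_in_open[of "{..<0}" x] by (auto elim: eventually_mono)
  qed
  have "\<forall>\<^sub>F y in nhds x. sgn y * f \<bar>y\<bar> = sgn x * f \<bar>y\<bar>"
    using sgn_eq by eventually_elim simp
  then show ?thesis
    using deriv by (subst DERIV_cong_ev[OF refl _ refl])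
qed

text \<open>The difference quotient of \<open>f\<close> at 0 is squeezed by that of \<open>g\<close>
  at the absolute value of the argument. A one-sided derivative of \<open>g\<close> thus yields a
  two-sided one of \<open>f\<close>, which settles the origin for even and odd extensions.\<close>

lemma has_real_derivative_0_if_dominated:
  fixes f g :: "real \<Rightarrow> real"
  assumes "(g has_real_derivative 0) (at 0 within {0..})" "g 0 = 0"
    and "\<And>y. \<bar>f y\<bar> \<le> \<bar>g \<bar>y\<bar>\<bar>"
  shows "(f has_real_derivative 0) (at 0)"
proof -
  have f0: "f 0 = 0"
    using assms(3)[of 0] assms(2) by simp
  have "((\<lambda>x. g x / x) \<longlongrightarrow> 0) (at 0 within {0..})"
    using assms(1,2) by (simp add: has_field_derivative_iff)
  moreover have "filterlim (\<lambda>y::real. \<bar>y\<bar>) (at 0 within {0..}) (at 0)"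
    by (auto simp: filterlim_at eventually_at_filter intro!: tendsto_eq_intros)
  ultimately have "((\<lambda>y. \<bar>g \<bar>y\<bar> / \<bar>y\<bar>\<bar>) \<longlongrightarrow> 0) (at 0)"
    by (intro tendsto_rabs_zero) (rule filterlim_compose)
  then have "((\<lambda>y. f y / y) \<longlongrightarrow> 0) (at 0)"
    by (rule Lim_null_comparison[rotated])
      (use assms(3) in \<open>auto intro!: always_eventually divide_right_mono\<close>)
  then show ?thesis
    using f0 by (simp add: has_field_derivative_iff)
qed

section \<open>The initial value problem\<close>

text \<open>The parameter \<open>v\<close> names the derivative whose existence
  \<open>solves_ivp\<close> asserts; the absolute value in the equation drops out because
  \<open>x > 0\<close>.\<close>

locale emden_fowler_ivp =
  fixes l :: real and w v :: "real \<Rightarrow> real"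
  assumes l_pos: "l > 0"
    and w_deriv_within: "x \<ge> 0 \<Longrightarrow> (w has_real_derivative v x) (at x within {0..})"
    and v_deriv: "x > 0 \<Longrightarrow> (v has_real_derivative - (x powr l * exp (w x))) (at x)"
    and w_0 [simp]: "w 0 = 0" and v_0 [simp]: "v 0 = 0"
begin

section \<open>Sign and monotonicity of the solution and its derivative\<close>

lemma w_deriv: "x > 0 \<Longrightarrow> (w has_real_derivative v x) (at x)"
  using w_deriv_within[of x] by (simp add: at_within_interior[of x "{0..}"])

lemma continuous_on_w: "continuous_on {0..} w"
  using w_deriv_within by (meson DERIV_continuous_on atLeast_iff)

lemma v_strict_antimono:
  assumes "0 < x" "x < y"
  shows "v y < v x"
proof (rule DERIV_neg_imp_decreasing[OF assms(2)])
  show "\<exists>d. (v has_real_derivative d) (at t) \<and> d < 0" if "x \<le> t" "t \<le> y" for t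
    using v_deriv[of t] that assms by (intro exI[of _ "- (t powr l * exp (w t))"]) auto
qed

text \<open>This is \<open>v 0 = 0\<close> read as a limit of difference quotients; it serves in
  place of continuity of \<open>v\<close> at 0.\<close>

lemma tendsto_w_quotient: "((\<lambda>t. w t / t) \<longlongrightarrow> 0) (at_right 0)"
proof -
  have "((\<lambda>t. w t / t) \<longlongrightarrow> 0) (at 0 within {0..})"
    using w_deriv_within[of 0] by (simp add: has_field_derivative_iff)
  then show ?thesis
    by (rule tendsto_within_subset) auto
qed

lemma w_quotient_eq_v:
  assumes "0 < t"
  obtains s where "0 < s" "s < t" "w t / t = v s"
proof -
  have "continuous_on {0..t} w"
    by (rule continuous_on_subset[OF continuous_on_w]) auto
  then obtain d s where s: "0 < s" "s < t" "(w has_real_derivative d) (at s)" "w t - w 0 = (t - 0) * d"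
    using MVT[of 0 t w] w_deriv assms real_differentiable_def by metis
  then have "d = v s"
    using DERIV_unique w_deriv by blast
  then show ?thesis
    using that s assms by (auto simp: field_simps)
qed

text \<open>For \<open>s < t < y\<close> with \<open>w t / t = v s\<close>, monotonicity gives
  \<open>v y < w t / t\<close>; letting \<open>t\<close> tend to 0 yields
  \<open>v y \<le> 0\<close>. Comparison with the value at \<open>x / 2\<close> makes the inequality
  strict.\<close>

lemma v_neg:
  assumes "x > 0"
  shows "v x < 0"
proof -
  have nonpos: "v y \<le> 0" if "y > 0" for y
  proof (rule tendsto_lowerbound[OF tendsto_w_quotient])
    show "\<forall>\<^sub>F t in at_right 0. v y \<le> w t / t"
      using eventually_at_right_less[of 0] eventually_at_right_real[OF that]
    proof eventually_elim
      case (elim t)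
      then obtain s where "0 < s" "s < t" "w t / t = v s"
        using w_quotient_eq_v by auto
      then show ?case
        using v_strict_antimono[of s y] elim by simp
    qed
  qed simp
  show ?thesis
    using nonpos[of "x / 2"] v_strict_antimono[of "x / 2" x] assms by simp
qed

lemma w_strict_antimono:
  assumes "0 \<le> x" "x < y"
  shows "w y < w x"
proof (rule DERIV_neg_imp_decreasing_open[OF assms(2)])
  show "\<exists>d. (w has_real_derivative d) (at t) \<and> d < 0" if "x < t" "t < y" for t
    using w_deriv[of t] v_neg[of t] that assms by auto
  show "continuous_on {x..y} w"
    using continuous_on_w by (rule continuous_on_subset) (use assms in auto)
qed

lemma w_nonpos: "x \<ge> 0 \<Longrightarrow> w x \<le> 0"
  using w_strict_antimono[of 0 x] by (cases "x = 0") auto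

text \<open>
  Continuity of \<open>v\<close> at \<open>0\<close> is not part of the problem. The mean value theorem yields points
  tending to \<open>0\<close> at which \<open>v\<close> equals a difference quotient of \<open>w\<close>; the differential equation
  controls \<open>v\<close> from there.
\<close>

lemma v_lower_bound:
  assumes "x > 0"
  shows "- (x * x powr l) \<le> v x"
proof -
  have "0 \<le> v x + x * x powr l"
  proof (rule tendsto_upperbound[OF tendsto_w_quotient])
    show "\<forall>\<^sub>F t in at_right 0. w t / t \<le> v x + x * x powr l"
      using eventually_at_right_less[of 0] eventually_at_right_real[OF assms]
    proof eventually_elim
      case (elim t)
      then obtain s where s: "0 < s" "s < t" "w t / t = v s"
        using w_quotient_eq_v by auto
      then obtain z where z: "s < z" "z < x" "v x - v s = (x - s) * - (z powr l * exp (w z))"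
        using MVT2[of s x v "\<lambda>z. - (z powr l * exp (w z))"] v_deriv elim by auto
      \<comment> \<open>Since \<open>w z \<le> 0\<close>, the exponential is at most 1, so
        \<open>v\<close> falls by at most \<open>x * x powr l\<close> between \<open>s\<close> and
        \<open>x\<close>.\<close>
      have "z powr l * exp (w z) \<le> x powr l * 1"
        using z s l_pos w_nonpos[of z] by (intro mult_mono powr_mono2) auto
      then have "(x - s) * (z powr l * exp (w z)) \<le> x * (x powr l)"
        using z s by (intro mult_mono) auto
      then show ?case
        using z s by simp
    qed
  qed simp
  then show ?thesis by simp
qed

section \<open>Regularity of the extensions to the whole line\<close>

lemma even_extension_deriv: "((\<lambda>y. w \<bar>y\<bar>) has_real_derivative sgn y * v \<bar>y\<bar>) (at y)"
proof (cases "y = 0")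
  case True
  have "((\<lambda>y. w \<bar>y\<bar>) has_real_derivative 0) (at 0)"
    using w_deriv_within[of 0] by (intro has_real_derivative_0_if_dominated[of w]) auto
  with True show ?thesis by simp
next
  case False
  then show ?thesis
    by (intro has_real_derivative_abs_comp w_deriv) auto
qed

text \<open>At 0 the extension is dominated by \<open>x * x powr l\<close>, whose derivative there
  vanishes because \<open>l > 0\<close>; elsewhere the differential equation applies.\<close>

lemma odd_extension_deriv:
  "((\<lambda>y. sgn y * v \<bar>y\<bar>) has_real_derivative - (\<bar>y\<bar> powr l * exp (w \<bar>y\<bar>))) (at y)"
proof (cases "y = 0")
  case True
  have "((\<lambda>x. x powr l) \<longlongrightarrow> 0) (at 0 within {0..})"
    using l_pos by (intro tendsto_zero_powrI[where b = l]) (auto simp: eventually_at_filter)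
  then have "((\<lambda>x. x * x powr l / x) \<longlongrightarrow> 0) (at 0 within {0..})"
    by (rule Lim_transform_eventually) (auto simp: eventually_at_filter)
  then have "((\<lambda>x. x * x powr l) has_real_derivative 0) (at 0 within {0..})"
    by (simp add: has_field_derivative_iff)
  then have "((\<lambda>y. sgn y * v \<bar>y\<bar>) has_real_derivative 0) (at 0)"
  proof (rule has_real_derivative_0_if_dominated)
    show "\<bar>sgn y * v \<bar>y\<bar>\<bar> \<le> \<bar>\<bar>y\<bar> * \<bar>y\<bar> powr l\<bar>" for y
      using v_lower_bound[of "\<bar>y\<bar>"] v_neg[of "\<bar>y\<bar>"] by (cases "y = 0") (auto simp: abs_mult)
  qed simp
  with True l_pos show ?thesis by simp
next
  case False
  then show ?thesis
    using v_deriv[of "\<bar>y\<bar>"] by (intro has_real_derivative_sgn_abs_comp) auto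
qed

lemma C1_on_odd_extension: "C1_on UNIV (\<lambda>y. sgn y * v \<bar>y\<bar>)"
proof (rule C1_onI_real)
  have "continuous_on UNIV (\<lambda>y. w \<bar>y\<bar>)"
    using even_extension_deriv DERIV_isCont continuous_at_imp_continuous_on by blast
  then show "continuous_on UNIV (\<lambda>y. - (\<bar>y\<bar> powr l * exp (w \<bar>y\<bar>)))"
    using l_pos by (intro continuous_intros continuous_on_powr') auto
qed (use odd_extension_deriv in auto)

lemma C1_on_v: "C1_on {0<..} v"
proof (rule C1_onI_real)
  have "continuous_on {0<..} w"
    using continuous_on_w by (rule continuous_on_subset) auto
  then show "continuous_on {0<..} (\<lambda>y. - (y powr l * exp (w y)))"
    by (intro continuous_intros) auto
qed (auto intro: has_field_derivative_at_within v_deriv)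

text \<open>By concavity the graph lies below its tangent at 1, and \<open>w 1 \<le> 0\<close>
  allows the constant term to be dropped.\<close>

lemma w_linear_bound:
  assumes "x \<ge> 1"
  shows "w x \<le> v 1 * (x - 1)"
proof (cases "x = 1")
  case False
  then obtain z where z: "1 < z" "z < x" "w x - w 1 = (x - 1) * v z"
    using MVT2[of 1 x w v] w_deriv assms by auto
  have "(x - 1) * v z \<le> (x - 1) * v 1"
    using v_strict_antimono[of 1 z] z by (intro mult_left_mono) auto
  moreover have "w 1 \<le> 0"
    by (rule w_nonpos) simp
  ultimately show ?thesis
    using z by (subst mult.commute) linarith
qed (use w_nonpos in auto)

subsection \<open>The inverse of \<open>-w\<close>\<close>

lemma inj_on_w: "inj_on (\<lambda>x. - w x) {0..}"
  by (rule inj_onI) (metis atLeast_iff linorder_neqE_linordered_idom neg_equal_iff_equal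
      order_less_irrefl w_strict_antimono)

lemma eta_w [simp]: "x \<ge> 0 \<Longrightarrow> eta w (- w x) = x"
  unfolding eta_def by (rule inv_into_f_f[OF inj_on_w]) auto

lemma range_w:
  assumes "\<alpha> \<ge> 0"
  shows "\<alpha> \<in> (\<lambda>x. - w x) ` {0..}"
proof -
  \<comment> \<open>The point at which the linear upper bound on \<open>w\<close> equals
    \<open>- \<alpha>\<close>.\<close>
  define X where "X = 1 + \<alpha> / - v 1"
  have v1: "v 1 < 0" by (rule v_neg) simp
  then have X: "X \<ge> 1"
    using assms by (simp add: X_def divide_nonneg_neg)
  have "v 1 * (X - 1) = - \<alpha>"
    using v1 by (simp add: X_def)
  then have "\<alpha> \<le> - w X"
    using w_linear_bound[OF X] by simp
  moreover have "continuous_on {0..X} (\<lambda>x. - w x)"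
    by (intro continuous_intros continuous_on_subset[OF continuous_on_w]) auto
  ultimately obtain x where "0 \<le> x" "- w x = \<alpha>"
    using IVT'[of "\<lambda>x. - w x" 0 \<alpha> X] assms X by auto
  then show ?thesis by auto
qed

lemma w_eta [simp]: "\<alpha> \<ge> 0 \<Longrightarrow> w (eta w \<alpha>) = - \<alpha>"
  using f_inv_into_f[OF range_w] unfolding eta_def by (metis minus_minus)

lemma eta_nonneg: "\<alpha> \<ge> 0 \<Longrightarrow> eta w \<alpha> \<ge> 0"
  using inv_into_into[OF range_w] by (simp add: eta_def)

lemma eta_pos: "\<alpha> > 0 \<Longrightarrow> eta w \<alpha> > 0"
  using eta_nonneg[of \<alpha>] w_eta[of \<alpha>] by (cases "eta w \<alpha> = 0") auto

lemma eta_strict_mono: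
  assumes "0 \<le> \<alpha>" "\<alpha> < \<beta>"
  shows "eta w \<alpha> < eta w \<beta>"
proof (rule ccontr)
  assume "\<not> eta w \<alpha> < eta w \<beta>"
  then have "w (eta w \<alpha>) \<le> w (eta w \<beta>)"
    using eta_nonneg[of \<beta>] assms w_strict_antimono[of "eta w \<beta>" "eta w \<alpha>"]
    by (cases "eta w \<alpha> = eta w \<beta>") auto
  then show False
    using assms by simp
qed

text \<open>The linear bound on \<open>w\<close>, taken at \<open>eta w \<alpha>\<close> and solved
  for it; values below 1 satisfy the estimate trivially.\<close>

lemma eta_linear_bound:
  assumes "\<alpha> \<ge> 0"
  shows "eta w \<alpha> \<le> 1 + \<alpha> / - v 1"
proof (cases "eta w \<alpha> \<ge> 1")
  case True
  then show ?thesis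
    using w_linear_bound[OF True] assms v_neg[of 1] by (simp add: field_simps)
next
  case False
  then show ?thesis
    using assms v_neg[of 1] divide_nonneg_neg[of \<alpha> "v 1"] divide_nonneg_nonpos[of \<alpha> "v 1"] by simp
qed

lemma isCont_eta:
  assumes "\<alpha> > 0"
  shows "isCont (eta w) \<alpha>"
proof -
  let ?x = "eta w \<alpha>"
  have x: "?x > 0" using eta_pos assms by simp
  have z_pos: "z > 0" if "\<bar>z - ?x\<bar> \<le> ?x / 2" for z
    using that x by linarith
  have "isCont (eta w) (- w ?x)"
  \<comment> \<open>Radius \<open>?x / 2\<close> keeps the neighbourhood in the open half-line,
    where \<open>w\<close> is differentiable from both sides and \<open>eta w\<close> inverts
    \<open>- w\<close>.\<close>
  proof (rule isCont_inverse_function[where d = "?x / 2" and f = "\<lambda>x. - w x"])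
    show "isCont (\<lambda>x. - w x) z" if "\<bar>z - ?x\<bar> \<le> ?x / 2" for z
      using z_pos[OF that] by (intro continuous_minus DERIV_isCont[OF w_deriv])
    show "eta w (- w z) = z" if "\<bar>z - ?x\<bar> \<le> ?x / 2" for z
      using z_pos[OF that] by simp
  qed (use x in auto)
  then show ?thesis using assms by simp
qed

lemma eta_deriv:
  assumes "\<alpha> > 0"
  shows "(eta w has_real_derivative - inverse (v (eta w \<alpha>))) (at \<alpha>)"
proof -
  have "(eta w has_real_derivative inverse (- v (eta w \<alpha>))) (at \<alpha>)"
  \<comment> \<open>The interval only has to contain \<open>\<alpha>\<close> and consist of points
    where \<open>- w\<close> undoes \<open>eta w\<close>.\<close>
  proof (rule DERIV_inverse_function[where f = "\<lambda>x. - w x" and a = 0 and b = "\<alpha> + 1"])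
    show "((\<lambda>x. - w x) has_real_derivative - v (eta w \<alpha>)) (at (eta w \<alpha>))"
      by (intro DERIV_minus w_deriv eta_pos assms)
  qed (use assms v_neg[OF eta_pos[OF assms]] isCont_eta in auto)
  then show ?thesis by simp
qed

text \<open>A bootstrap on the formula for the derivative of \<open>eta w\<close>: continuity of
  \<open>eta w\<close> makes that derivative continuous, and once \<open>eta w\<close> is
  continuously differentiable, so is the derivative, through \<open>v\<close>.\<close>

lemma C1_on_eta: "C1_on {0<..} (eta w)"
  and C1_on_eta_deriv: "C1_on {0<..} (\<lambda>\<alpha>. - inverse (v (eta w \<alpha>)))"
proof -
  have v_nz: "v (eta w \<alpha>) \<noteq> 0" if "\<alpha> \<in> {0<..}" for \<alpha>
    using v_neg[OF eta_pos[of \<alpha>]] that by simp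
  have cont: "continuous_on {0<..} (eta w)"
    using isCont_eta by (simp add: continuous_at_imp_continuous_on)
  show C1: "C1_on {0<..} (eta w)"
  proof (rule C1_onI_real)
    show "continuous_on {0<..} (\<lambda>\<alpha>. - inverse (v (eta w \<alpha>)))"
      by (intro continuous_intros continuous_on_compose2[OF C1_on_imp_continuous_on[OF C1_on_v] cont])
        (use v_nz eta_pos in auto)
  qed (auto intro: has_field_derivative_at_within eta_deriv)
  have "C1_on {0<..} (\<lambda>\<alpha>. -1 * inverse (v (eta w \<alpha>)))"
    by (intro C1_on_mult C1_on_const C1_on_inverse C1_on_compose[OF C1_on_v C1])
      (use v_nz eta_pos in auto)
  then show "C1_on {0<..} (\<lambda>\<alpha>. - inverse (v (eta w \<alpha>)))" by simp
qed

text \<open>With \<open>?V\<close> the derivative of the even extension of \<open>w\<close>, the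
  partial derivatives are \<open>?e p * ?W p\<close> and \<open>fst p * ?e' p * ?W p + 1\<close>.
  Both are built by products and sums from continuously differentiable functions.\<close>

lemma C2_on_U: "C2_on ({-1..1} \<times> {0<..}) (\<lambda>(x, \<alpha>). U w x \<alpha>)"
proof (rule C2_onI_prod)
  let ?S = "{-1..1} \<times> {0<..} :: (real \<times> real) set"
  let ?e = "\<lambda>p :: real \<times> real. eta w (snd p)"
  let ?e' = "\<lambda>p :: real \<times> real. - inverse (v (eta w (snd p)))"
  let ?V = "\<lambda>y. sgn y * v \<bar>y\<bar>"
  let ?W = "\<lambda>p. ?V (?e p * fst p)"
  have fst: "C1_on ?S fst" and snd: "C1_on ?S snd"
    by (intro C1_on_bounded_linear bounded_linear_fst bounded_linear_snd)+
  have e: "C1_on ?S ?e"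
    by (rule C1_on_compose[OF C1_on_eta snd]) auto
  have e': "C1_on ?S ?e'"
    by (rule C1_on_compose[OF C1_on_eta_deriv snd]) auto
  have W: "C1_on ?S ?W"
    by (rule C1_on_compose[OF C1_on_odd_extension C1_on_mult[OF e fst] subset_UNIV])
  show "C1_on ?S (\<lambda>p. ?e p * ?W p)"
    by (rule C1_on_mult[OF e W])
  show "C1_on ?S (\<lambda>p. fst p * ?e' p * ?W p + 1)"
    by (rule C1_on_add[OF C1_on_mult[OF C1_on_mult[OF fst e'] W] C1_on_const])
  fix p assume p: "p \<in> ?S"
  \<comment> \<open>As \<open>eta w\<close> is nonnegative, it moves inside the absolute value, so
    \<open>U\<close> is the even extension of \<open>w\<close> composed with a product that is
    differentiable across \<open>x = 0\<close>.\<close>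
  have U_eq: "(\<lambda>(x, \<alpha>). U w x \<alpha>) q = w \<bar>?e q * fst q\<bar> + snd q" if "q \<in> ?S" for q
    using that eta_nonneg[of "snd q"] by (simp add: U_def abs_mult mem_Times_iff case_prod_unfold)
  have "(?e has_derivative (\<lambda>h. ?e' p * snd h)) (at p within ?S)"
    by (rule has_derivative_compose[OF has_derivative_snd[OF has_derivative_ident]
          eta_deriv[unfolded has_field_derivative_def]]) (use p in auto)
  then have mult: "((\<lambda>p. ?e p * fst p) has_derivative (\<lambda>h. ?e p * fst h + ?e' p * snd h * fst p)) (at p within ?S)"
    by (rule has_derivative_mult[OF _ has_derivative_fst[OF has_derivative_ident]])
  have "((\<lambda>p. w \<bar>?e p * fst p\<bar>) has_derivative
      (\<lambda>h. ?W p * (?e p * fst h + ?e' p * snd h * fst p))) (at p within ?S)"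
    by (rule has_derivative_compose[OF mult even_extension_deriv[unfolded has_field_derivative_def]])
  then have "((\<lambda>p. w \<bar>?e p * fst p\<bar> + snd p) has_derivative
      (\<lambda>h. ?W p * (?e p * fst h + ?e' p * snd h * fst p) + snd h)) (at p within ?S)"
    by (rule has_derivative_add[OF _ has_derivative_snd[OF has_derivative_ident]])
  moreover have "(\<lambda>h. ?W p * (?e p * fst h + ?e' p * snd h * fst p) + snd h) =
      (\<lambda>(h, k). ?e p * ?W p * h + (fst p * ?e' p * ?W p + 1) * k)"
    by (auto simp: fun_eq_iff algebra_simps)
  ultimately have deriv: "((\<lambda>p. w \<bar>?e p * fst p\<bar> + snd p) has_derivative
      (\<lambda>(h, k). ?e p * ?W p * h + (fst p * ?e' p * ?W p + 1) * k)) (at p within ?S)"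
    by simp
  show "((\<lambda>(x, \<alpha>). U w x \<alpha>) has_derivative
      (\<lambda>(h, k). ?e p * ?W p * h + (fst p * ?e' p * ?W p + 1) * k)) (at p within ?S)"
    by (rule has_derivative_transform[OF p _ deriv]) (rule U_eq)
qed

subsection \<open>The function \<open>\<lambda>\<close>\<close>

text \<open>Logarithmic differentiation. Keeping \<open>lam l w \<alpha>\<close> as a factor lets
  the regularity of the derivative be bootstrapped from that of \<open>lam l w\<close>.\<close>

lemma lam_deriv:
  assumes "\<alpha> > 0"
  shows "(lam l w has_real_derivative
    lam l w \<alpha> * ((l + 2) * (- inverse (v (eta w \<alpha>))) * inverse (eta w \<alpha>) + -1)) (at \<alpha>)"
proof -
  let ?x = "eta w \<alpha>"
  have x: "?x > 0" using eta_pos assms by simp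
  have "((\<lambda>\<alpha>. eta w \<alpha> powr (l + 2)) has_real_derivative
      ?x powr (l + 2) * (0 * ln ?x + - inverse (v ?x) * (l + 2) / ?x)) (at \<alpha>)"
    by (rule DERIV_powr[OF eta_deriv[OF assms] x DERIV_const])
  moreover have "((\<lambda>\<alpha>. exp (- \<alpha>)) has_real_derivative - exp (- \<alpha>)) (at \<alpha>)"
    by (auto intro!: derivative_eq_intros)
  ultimately have "((\<lambda>\<alpha>. eta w \<alpha> powr (l + 2) * exp (- \<alpha>)) has_real_derivative
      ?x powr (l + 2) * (0 * ln ?x + - inverse (v ?x) * (l + 2) / ?x) * exp (- \<alpha>)
      + - exp (- \<alpha>) * ?x powr (l + 2)) (at \<alpha>)"
    by (rule DERIV_mult)
  then show ?thesis
    unfolding lam_def[abs_def] by (rule DERIV_cong) (simp add: divide_inverse algebra_simps)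
qed

text \<open>The derivative is \<open>lam l w\<close> times the continuously differentiable factor
  \<open>?D\<close>: continuity of \<open>lam l w\<close> first gives one continuous derivative, and
  the same product formula then gives the second.\<close>

lemma C2_on_lam: "C2_on {0<..} (lam l w)"
proof (rule C2_onI_real)
  let ?D = "\<lambda>\<alpha>. (l + 2) * (- inverse (v (eta w \<alpha>))) * inverse (eta w \<alpha>) + -1"
  show "(lam l w has_real_derivative lam l w \<alpha> * ?D \<alpha>) (at \<alpha> within {0<..})" if "\<alpha> \<in> {0<..}" for \<alpha>
    by (rule has_field_derivative_at_within[OF lam_deriv]) (use that in simp)
  have D: "C1_on {0<..} ?D"
    by (intro C1_on_add C1_on_mult C1_on_const C1_on_eta_deriv C1_on_inverse C1_on_eta)
      (use eta_pos in force)
  have "continuous_on {0<..} (lam l w)"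
    by (intro continuous_at_imp_continuous_on ballI DERIV_isCont[OF lam_deriv]) simp
  then have "C1_on {0<..} (lam l w)"
    by (intro C1_onI_real[where f' = "\<lambda>\<alpha>. lam l w \<alpha> * ?D \<alpha>"] continuous_on_mult
        C1_on_imp_continuous_on[OF D] has_field_derivative_at_within[OF lam_deriv]) auto
  then show "C1_on {0<..} (\<lambda>\<alpha>. lam l w \<alpha> * ?D \<alpha>)"
    by (rule C1_on_mult[OF _ D])
qed

section \<open>Limits at both ends of the parameter range\<close>

text \<open>By monotonicity, \<open>eta w \<alpha>\<close> is below \<open>a\<close> as soon as
  \<open>\<alpha>\<close> is below \<open>- w a\<close>, which is positive.\<close>

lemma eta_tendsto_0: "(eta w \<longlongrightarrow> 0) (at_right 0)"
proof (rule order_tendstoI)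
  show "\<forall>\<^sub>F \<alpha> in at_right 0. a < eta w \<alpha>" if "a < 0" for a
    using eventually_at_right_less[of 0] by eventually_elim (use that eta_pos in force)
next
  fix a :: real assume a: "0 < a"
  then have "w a < 0"
    using w_strict_antimono[of 0 a] by simp
  then have "\<forall>\<^sub>F \<alpha> in at_right 0. \<alpha> \<in> {0<..<- w a}"
    by (intro eventually_at_right_real) simp
  then show "\<forall>\<^sub>F \<alpha> in at_right 0. eta w \<alpha> < a"
    by eventually_elim (use a eta_strict_mono[of _ "- w a"] in auto)
qed

lemma lam_tendsto_0_at_0: "(lam l w \<longlongrightarrow> 0) (at_right 0)"
proof -
  have "\<forall>\<^sub>F \<alpha> in at_right 0. 0 \<le> eta w \<alpha>"
    using eventually_at_right_less[of 0] by eventually_elim (simp add: eta_nonneg)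
  then have "((\<lambda>\<alpha>. eta w \<alpha> powr (l + 2)) \<longlongrightarrow> 0) (at_right 0)"
    using l_pos by (intro tendsto_zero_powrI[OF eta_tendsto_0 tendsto_const]) auto
  then have "((\<lambda>\<alpha>. eta w \<alpha> powr (l + 2) * exp (- \<alpha>)) \<longlongrightarrow> 0 * exp (- 0)) (at_right 0)"
    by (intro tendsto_intros)
  then show ?thesis
    by (simp add: lam_def[abs_def])
qed

lemma lam_tendsto_0_at_top: "(lam l w \<longlongrightarrow> 0) at_top"
proof (rule Lim_null_comparison)
  define c where "c = - v 1"
  have "c > 0" using v_neg[of 1] by (simp add: c_def)
  then show "((\<lambda>\<alpha>. (1 + \<alpha> / c) powr (l + 2) * exp (- \<alpha>)) \<longlongrightarrow> 0) at_top"
    by real_asymp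
  show "\<forall>\<^sub>F \<alpha> in at_top. norm (lam l w \<alpha>) \<le> (1 + \<alpha> / c) powr (l + 2) * exp (- \<alpha>)"
    using eventually_ge_at_top[of 0]
  proof eventually_elim
    case (elim \<alpha>)
    have "eta w \<alpha> powr (l + 2) \<le> (1 + \<alpha> / c) powr (l + 2)"
      using eta_linear_bound[OF elim] eta_nonneg[OF elim] l_pos
      by (intro powr_mono2) (auto simp: c_def)
    then show ?case
      by (simp add: lam_def abs_mult)
  qed
qed

section \<open>Sign of the derivative and the unique critical point\<close>

text \<open>The intermediate term is \<open>y * v x\<close>: first \<open>v\<close> decreases, then
  the factor multiplying the negative number \<open>v x\<close> grows.\<close>

lemma mult_v_strict_antimono:
  assumes "0 < x" "x < y"
  shows "y * v y < x * v x"
  by (rule less_trans[OF mult_strict_left_mono[OF v_strict_antimono[OF assms]]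
        mult_strict_right_mono_neg[OF assms(2) v_neg[OF assms(1)]]]) (use assms in simp)

lemma mult_v_critical_point: "\<exists>x>0. l + 2 + x * v x = 0"
proof -
  let ?g = "\<lambda>x. l + 2 + x * v x"
  \<comment> \<open>Endpoints for the intermediate value theorem, both controlled by
    \<open>v 1\<close>. Since \<open>a \<le> 1\<close>,
    \<open>a * v a \<ge> a * v 1 \<ge> - 1\<close>; since \<open>b > 1\<close>,
    \<open>b * v b \<le> b * v 1 = v 1 - (l + 2)\<close>.\<close>
  define a where "a = min 1 (- 1 / v 1)"
  define b where "b = 1 + (l + 2) / - v 1"
  have v1: "v 1 < 0" by (rule v_neg) simp
  have a: "0 < a" "a \<le> 1" "- 1 \<le> a * v 1"
    using v1 by (auto simp: a_def min_def field_simps mult_neg_neg)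
  have b: "1 < b" "b * v 1 < - (l + 2)"
    using v1 l_pos by (auto simp: b_def field_simps mult_neg_neg)
  have "a * v 1 \<le> a * v a"
    using v_strict_antimono[of a 1] a by (cases "a = 1") auto
  then have ga: "0 \<le> ?g a"
    using a l_pos by linarith
  have "b * v b \<le> b * v 1"
    using v_strict_antimono[of 1 b] b by (intro mult_left_mono) auto
  then have gb: "?g b \<le> 0"
    using b by linarith
  have "continuous_on {a..b} v"
    by (rule continuous_on_subset[OF C1_on_imp_continuous_on[OF C1_on_v]]) (use a in auto)
  then have "continuous_on {a..b} ?g"
    by (intro continuous_intros)
  then obtain x where "a \<le> x" "?g x = 0"
    using IVT2'[of ?g b 0 a] ga gb a b by auto
  then show ?thesis
    using a by (intro exI[of _ x]) auto
qed

text \<open>The factor \<open>k\<close> is \<open>lam l w\<close> times the logarithmic derivative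
  of \<open>eta w\<close>; extracting it reduces the sign of the derivative to that of
  \<open>l + 2 + x * v x\<close> at \<open>x = eta w \<alpha>\<close>.\<close>

lemma deriv_lam:
  assumes "\<alpha> > 0"
  obtains k where "k > 0" "deriv (lam l w) \<alpha> = k * (l + 2 + eta w \<alpha> * v (eta w \<alpha>))"
proof
  let ?x = "eta w \<alpha>"
  have x: "?x > 0" "v ?x < 0" using eta_pos v_neg assms by auto
  show "0 < lam l w \<alpha> * (- inverse (v ?x)) * inverse ?x"
    using x by (intro mult_pos_pos) (auto simp: lam_def)
  show "deriv (lam l w) \<alpha> = lam l w \<alpha> * (- inverse (v ?x)) * inverse ?x * (l + 2 + ?x * v ?x)"
    using DERIV_imp_deriv[OF lam_deriv[OF assms]] x by (simp add: field_simps)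
qed

text \<open>The zero \<open>x\<close> of \<open>l + 2 + x * v x\<close> corresponds to the parameter
  \<open>- w x\<close>. As \<open>eta w\<close> increases and \<open>x * v x\<close> decreases, the
  sign is positive before this parameter and negative after it.\<close>

lemma lam_unimodal:
  "\<exists>a>0. (\<forall>\<alpha>. 0 < \<alpha> \<and> \<alpha> < a \<longrightarrow> deriv (lam l w) \<alpha> > 0) \<and> deriv (lam l w) a = 0 \<and>
    (\<forall>\<alpha>>a. deriv (lam l w) \<alpha> < 0)"
proof -
  obtain x where x: "x > 0" "l + 2 + x * v x = 0"
    using mult_v_critical_point by blast
  define a where "a = - w x"
  have a: "a > 0" "eta w a = x"
    using x w_strict_antimono[of 0 x] by (auto simp: a_def)
  have "deriv (lam l w) \<alpha> > 0" if "0 < \<alpha>" "\<alpha> < a" for \<alpha>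
  proof -
    obtain k where k: "k > 0" "deriv (lam l w) \<alpha> = k * (l + 2 + eta w \<alpha> * v (eta w \<alpha>))"
      using deriv_lam[OF \<open>0 < \<alpha>\<close>] by blast
    have "x * v x < eta w \<alpha> * v (eta w \<alpha>)"
      using mult_v_strict_antimono[OF eta_pos[OF \<open>0 < \<alpha>\<close>]] eta_strict_mono[of \<alpha> a] that a by simp
    then show ?thesis
      using k x by simp
  qed
  moreover have "deriv (lam l w) a = 0"
    by (rule deriv_lam[OF a(1)]) (simp add: a(2) x(2))
  moreover have "deriv (lam l w) \<alpha> < 0" if "a < \<alpha>" for \<alpha>
  proof -
    obtain k where k: "k > 0" "deriv (lam l w) \<alpha> = k * (l + 2 + eta w \<alpha> * v (eta w \<alpha>))"
      using deriv_lam[OF less_trans[OF a(1) \<open>a < \<alpha>\<close>]] by blast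
    have "eta w \<alpha> * v (eta w \<alpha>) < x * v x"
      using mult_v_strict_antimono[OF x(1)] eta_strict_mono[of a \<alpha>] that a by simp
    then show ?thesis
      using k x by (simp add: mult_pos_neg)
  qed
  ultimately show ?thesis
    using a by blast
qed

end

theorem proposition1p1:
  fixes l :: real and w :: "real \<Rightarrow> real"
  assumes "l > 0"
    and "solves_ivp l w"
  shows "C2_on {0<..} (lam l w) \<and>
    C2_on ({-1..1} \<times> {0<..}) (\<lambda>(x, \<alpha>). U w x \<alpha>) \<and>
    (lam l w \<longlongrightarrow> 0) (at_right 0) \<and>
    (lam l w \<longlongrightarrow> 0) at_top \<and>
    (\<exists>a>0.
       (\<forall>\<alpha>. 0 < \<alpha> \<and> \<alpha> < a \<longrightarrow> deriv (lam l w) \<alpha> > 0) \<and>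
       deriv (lam l w) a = 0 \<and>
       (\<forall>\<alpha>>a. deriv (lam l w) \<alpha> < 0))"
proof -
  obtain v where "\<forall>x\<ge>0. (w has_real_derivative v x) (at x within {0..})"
    and "\<forall>x>0. (v has_real_derivative - (\<bar>x\<bar> powr l * exp (w x))) (at x)"
    and "w 0 = 0" "v 0 = 0"
    using assms(2) unfolding solves_ivp_def by blast
  then interpret emden_fowler_ivp l w v
    using assms(1) by unfold_locales (simp_all add: abs_of_pos)
  show ?thesis
    using C2_on_lam C2_on_U lam_tendsto_0_at_0 lam_tendsto_0_at_top lam_unimodal by blast
qed

end
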